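(* Let $(C_1,C_2)$ be an admissible pair of kernels (as defined in the context), with Lipschitz functions $\mu_1,\mu_2$. Let $f\in AA(\mathbb{R}\times\mathbb{X}\times\mathbb{X};\mathbb{X})$ be $L_f$-Lipschitz, that is, $$\|f(t,x,y)-f(t,x_1,y_1)\|\le L_f\big(\|x-x_1\|+\|y-y_1\|\big)$$ for $t\in\mathbb{R}$ and $(x,y),(x_1,y_1)$ in bounded subsets of $\mathbb{X}\times\mathbb{X}$. Suppose that $$L_f+\sup_{t\in\mathbb{R}}\left(\int_{-\infty}^t\mu_1(t,s)\,ds+\int_t^{+\infty}\mu_2(t,s)\,ds\right)=\rho<1,$$ and that $a_0,a_1,a_2\in AA(\mathbb{R};\mathbb{R})$. Then a bounded continuous solution $y:\mathbb{R}\to\mathbb{X}$ of the integral equation $$y(t)=f(t,y(t),y(a_0(t)))+\int_{-\infty}^{t}C_1(t,s,y(s),y(a_1(s)))\,ds+\int_{t}^{+\infty}C_2(t,s,y(s),y(a_2(s)))\,ds,\quad t\in\mathbb{R},$$ is almost automorphic if and only if it has relatively compact range.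
   Context: $\mathbb{X}$ is a Banach space. $AA(\mathbb{R};\mathbb{Z})$ (almost automorphic functions into a Banach space $\mathbb{Z}$): bounded continuous $f:\mathbb{R}\to\mathbb{Z}$ such that every real sequence $(s_n')$ has a subsequence $(s_n)$ and there is a function $\tilde f$ with $\lim_n f(t+s_n)=\tilde f(t)$ and $\lim_n\tilde f(t-s_n)=f(t)$ for each $t\in\mathbb{R}$. $AA(\mathbb{R}\times\mathbb{Y};\mathbb{X})$ ($\mathbb{Y}$ a Banach space): bounded continuous $f:\mathbb{R}\times\mathbb{Y}\to\mathbb{X}$ such that for every bounded $\mathcal{B}\subset\mathbb{Y}$ and every real sequence $(s_n')$ there are a subsequence $(s_n)$ and a function $\tilde f$ with $\lim_n f(t+s_n,x)=\tilde f(t,x)$ and $\lim_n\tilde f(t-s_n,x)=f(t,x)$, pointwise in $t\in\mathbb{R}$ and uniformly for $x\in\mathcal{B}$. Bi-almost automorphic: a jointly continuous $C:\mathbb{R}\times\mathbb{R}\times\mathbb{X}\times\mathbb{X}\to\mathbb{X}$ such that for every real sequence and every bounded $\mathcal{B}\subset\mathbb{X}\times\mathbb{X}$ there is a subsequence $(s_n)$ with $\tilde C(t,s,x,y):=\lim_n C(t+s_n,s+s_n,x,y)$ existing and $\lim_n\tilde C(t-s_n,s-s_n,x,y)=C(t,s,x,y)$, for each $(t,s)\in\mathbb{R}^2$ and uniformly for $(x,y)\in\mathcal{B}$. Such $\tilde C$ are called limit functions of $C$. $\lambda$-bounded: there is a positive function $\lambda:\mathbb{R}\times\mathbb{R}\to\mathbb{R}$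 such that $\|C(t+\tau,s+\tau,x,y)\|\le\lambda(t,s)$ for all $t,s,\tau\in\mathbb{R}$, uniformly for $(x,y)$ in bounded subsets of $\mathbb{X}\times\mathbb{X}$ (the same $\lambda$ for all bounded subsets). $(\mu,\tilde\mu)$-Lipschitz: there are functions $\mu,\tilde\mu:\mathbb{R}\times\mathbb{R}\to[0,\infty)$ such that, for $(u_1,u_2),(v_1,v_2)$ in bounded subsets of $\mathbb{X}\times\mathbb{X}$, $\|C(t,s,u_1,u_2)-C(t,s,v_1,v_2)\|\le\mu(t,s)(\|u_1-v_1\|+\|u_2-v_2\|)$, and the same holds with $\tilde C$ (the limit functions), $\tilde\mu$ in place of $C,\mu$. Admissible pair of kernels: $C_1,C_2:\mathbb{R}\times\mathbb{R}\times\mathbb{X}\times\mathbb{X}\to\mathbb{X}$ are Bi-almost automorphic, $C_i$ is $\lambda_i$-bounded and $(\mu_i,\tilde\mu_i)$-Lipschitz, with $\sup_t\int_{-\infty}^t\lambda_1(t,s)ds<\infty$, $\sup_t\int_t^{+\infty}\lambda_2(t,s)ds<\infty$, $\sup_t\int_{-\infty}^t\mu_1(t,s)ds<\infty$, $\sup_t\int_t^{+\infty}\mu_2(t,s)ds<\infty$. *)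

theory Defs
  imports "HOL-Analysis.Analysis"
begin

definition almost_automorphic :: "(real \<Rightarrow> 'z::banach) \<Rightarrow> bool" where
  "almost_automorphic f \<longleftrightarrow>
     bounded (range f) \<and> continuous_on UNIV f \<and>
     (\<forall>\<sigma>' :: nat \<Rightarrow> real. \<exists>r f'. strict_mono r \<and>
        (let \<sigma> = \<sigma>' \<circ> r in
          (\<forall>t. (\<lambda>n. f (t + \<sigma> n)) \<longlonglongrightarrow> f' t) \<and>
          (\<forall>t. (\<lambda>n. f' (t - \<sigma> n)) \<longlonglongrightarrow> f t)))"

text \<open>
  The limit \<open>f'\<close> may depend on the bounded set \<open>B\<close>; its values matter only on \<open>B\<close>.
  Below, \<open>'y\<close> is a product \<open>'x \<times> 'x\<close>, whose library norm is the Euclidean combination of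
  the two norms; it has the same bounded sets and the same topology as the sum of the norms.
\<close>

definition almost_automorphic_param :: "(real \<Rightarrow> 'y::banach \<Rightarrow> 'x::banach) \<Rightarrow> bool" where
  "almost_automorphic_param f \<longleftrightarrow>
     bounded (range (\<lambda>(t, p). f t p)) \<and> continuous_on UNIV (\<lambda>(t, p). f t p) \<and>
     (\<forall>B (\<sigma>' :: nat \<Rightarrow> real). bounded B \<longrightarrow> (\<exists>r f'. strict_mono r \<and>
        (let \<sigma> = \<sigma>' \<circ> r in
          (\<forall>t. uniform_limit B (\<lambda>n. f (t + \<sigma> n)) (f' t) sequentially) \<and>
          (\<forall>t. uniform_limit B (\<lambda>n. f' (t - \<sigma> n)) (f t) sequentially))))"

text \<open>
  \<open>bi_limit_function C B \<sigma> C'\<close>: along the (already extracted) sequence \<open>\<sigma>\<close>, \<open>C'\<close> is a limit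
  function of \<open>C\<close> relative to \<open>B\<close>. Only the values of \<open>C'\<close> on \<open>B\<close> are determined.
\<close>

definition bi_limit_function ::
  "(real \<Rightarrow> real \<Rightarrow> 'x::banach \<times> 'x \<Rightarrow> 'x) \<Rightarrow> ('x \<times> 'x) set \<Rightarrow> (nat \<Rightarrow> real) \<Rightarrow>
   (real \<Rightarrow> real \<Rightarrow> 'x \<times> 'x \<Rightarrow> 'x) \<Rightarrow> bool" where
  "bi_limit_function C B \<sigma> C' \<longleftrightarrow>
     (\<forall>t s. uniform_limit B (\<lambda>n. C (t + \<sigma> n) (s + \<sigma> n)) (C' t s) sequentially) \<and>
     (\<forall>t s. uniform_limit B (\<lambda>n. C' (t - \<sigma> n) (s - \<sigma> n)) (C t s) sequentially)"

definition bi_almost_automorphic :: "(real \<Rightarrow> real \<Rightarrow> 'x::banach \<times> 'x \<Rightarrow> 'x) \<Rightarrow> bool" where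
  "bi_almost_automorphic C \<longleftrightarrow>
     continuous_on UNIV (\<lambda>(t, s, p). C t s p) \<and>
     (\<forall>(\<sigma>' :: nat \<Rightarrow> real) B. bounded B \<longrightarrow>
        (\<exists>r C'. strict_mono r \<and> bi_limit_function C B (\<sigma>' \<circ> r) C'))"

definition lambda_bounded ::
  "(real \<Rightarrow> real \<Rightarrow> real) \<Rightarrow> (real \<Rightarrow> real \<Rightarrow> 'x::banach \<times> 'x \<Rightarrow> 'x) \<Rightarrow> bool" where
  "lambda_bounded lam C \<longleftrightarrow>
     (\<forall>t s. 0 < lam t s) \<and>
     (\<forall>B. bounded B \<longrightarrow>
        (\<forall>t s \<tau>. \<forall>p\<in>B. norm (C (t + \<tau>) (s + \<tau>) p) \<le> lam t s))"

definition pair_lipschitz_on ::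
  "real \<Rightarrow> ('x::banach \<times> 'x) set \<Rightarrow> ('x \<times> 'x \<Rightarrow> 'x) \<Rightarrow> bool" where
  "pair_lipschitz_on L B g \<longleftrightarrow>
     (\<forall>(u1, u2)\<in>B. \<forall>(v1, v2)\<in>B.
        norm (g (u1, u2) - g (v1, v2)) \<le> L * (norm (u1 - v1) + norm (u2 - v2)))"

definition mu_lipschitz ::
  "(real \<Rightarrow> real \<Rightarrow> real) \<Rightarrow> (real \<Rightarrow> real \<Rightarrow> real) \<Rightarrow>
   (real \<Rightarrow> real \<Rightarrow> 'x::banach \<times> 'x \<Rightarrow> 'x) \<Rightarrow> bool" where
  "mu_lipschitz \<mu> \<mu>' C \<longleftrightarrow>
     (\<forall>t s. 0 \<le> \<mu> t s) \<and> (\<forall>t s. 0 \<le> \<mu>' t s) \<and>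
     (\<forall>B. bounded B \<longrightarrow> (\<forall>t s. pair_lipschitz_on (\<mu> t s) B (C t s))) \<and>
     (\<forall>B \<sigma> C'. bounded B \<longrightarrow> bi_limit_function C B \<sigma> C' \<longrightarrow>
        (\<forall>t s. pair_lipschitz_on (\<mu>' t s) B (C' t s)))"

text \<open>
  Integrals are Henstock--Kurzweil integrals, because the library's Bochner integral needs a
  second countable codomain. For the nonnegative scalar kernels below they are Lebesgue integrals.
  The vector-valued integrands of the integral equation are continuous in \<open>s\<close> and dominated in norm
  by an integrable function, so there the integral is the usual (Bochner or improper Riemann) one.
\<close>

definition bounded_left_integrals :: "(real \<Rightarrow> real \<Rightarrow> real) \<Rightarrow> bool" where
  "bounded_left_integrals k \<longleftrightarrow>
     (\<forall>t. k t integrable_on {..t}) \<and> bdd_above (range (\<lambda>t. integral {..t} (k t)))"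

definition bounded_right_integrals :: "(real \<Rightarrow> real \<Rightarrow> real) \<Rightarrow> bool" where
  "bounded_right_integrals k \<longleftrightarrow>
     (\<forall>t. k t integrable_on {t..}) \<and> bdd_above (range (\<lambda>t. integral {t..} (k t)))"

definition admissible_kernels ::
  "(real \<Rightarrow> real \<Rightarrow> 'x::banach \<times> 'x \<Rightarrow> 'x) \<Rightarrow> (real \<Rightarrow> real \<Rightarrow> 'x \<times> 'x \<Rightarrow> 'x) \<Rightarrow>
   (real \<Rightarrow> real \<Rightarrow> real) \<Rightarrow> (real \<Rightarrow> real \<Rightarrow> real) \<Rightarrow> bool" where
  "admissible_kernels C1 C2 \<mu>1 \<mu>2 \<longleftrightarrow>
     bi_almost_automorphic C1 \<and> bi_almost_automorphic C2 \<and>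
     (\<exists>lam1. lambda_bounded lam1 C1 \<and> bounded_left_integrals lam1) \<and>
     (\<exists>lam2. lambda_bounded lam2 C2 \<and> bounded_right_integrals lam2) \<and>
     (\<exists>\<mu>1'. mu_lipschitz \<mu>1 \<mu>1' C1) \<and> bounded_left_integrals \<mu>1 \<and>
     (\<exists>\<mu>2'. mu_lipschitz \<mu>2 \<mu>2' C2) \<and> bounded_right_integrals \<mu>2"

definition solves_integral_equation ::
  "(real \<Rightarrow> 'x::banach \<times> 'x \<Rightarrow> 'x) \<Rightarrow>
   (real \<Rightarrow> real \<Rightarrow> 'x \<times> 'x \<Rightarrow> 'x) \<Rightarrow> (real \<Rightarrow> real \<Rightarrow> 'x \<times> 'x \<Rightarrow> 'x) \<Rightarrow>
   (real \<Rightarrow> real) \<Rightarrow> (real \<Rightarrow> real) \<Rightarrow> (real \<Rightarrow> real) \<Rightarrow> (real \<Rightarrow> 'x) \<Rightarrow> bool" where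
  "solves_integral_equation f C1 C2 a0 a1 a2 y \<longleftrightarrow>
     (\<forall>t. (\<lambda>s. C1 t s (y s, y (a1 s))) integrable_on {..t} \<and>
          (\<lambda>s. C2 t s (y s, y (a2 s))) integrable_on {t..} \<and>
          y t = f t (y t, y (a0 t))
                + integral {..t} (\<lambda>s. C1 t s (y s, y (a1 s)))
                + integral {t..} (\<lambda>s. C2 t s (y s, y (a2 s))))"

end

theory Submission
  imports Defs "HOL-Library.Diagonal_Subsequence"
begin

text \<open>
  Every bounded continuous solution \<open>y\<close> is in fact almost automorphic, and almost automorphic
  functions have relatively compact range. Since \<open>y\<close> is continuous, the delayed terms
  \<open>y \<circ> a\<^sub>i\<close> are almost automorphic. Freezing them in the right-hand side of the integral equation gives
  an operator \<open>T\<close> that preserves almost automorphy, is a \<open>\<rho>\<close>-contraction in the supremum norm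
  (without the freezing the constant would only be \<open>2\<rho>\<close>), and has \<open>y\<close> as a fixed point. Hence
  \<open>y\<close> is the uniform limit of the almost automorphic functions \<open>T\<^sup>n 0\<close>. Invariance under \<open>T\<close>
  rests on the substitution \<open>s \<mapsto> t + s\<close>, after which all kernel integrands share the dominating
  function \<open>\<lambda>(0, \<cdot>)\<close>.
\<close>

section \<open>Almost automorphic functions and their closure properties\<close>

text \<open>Separates the two limits from the extraction of a subsequence, so that successive
  extractions can be composed while a fixed limit function is kept.\<close>

definition aa_along :: "(real \<Rightarrow> 'a::metric_space) \<Rightarrow> (nat \<Rightarrow> real) \<Rightarrow> (real \<Rightarrow> 'a) \<Rightarrow> bool" where
  "aa_along f \<sigma> f' \<longleftrightarrow>
     (\<forall>t. (\<lambda>n. f (t + \<sigma> n)) \<longlonglongrightarrow> f' t) \<and> (\<forall>t. (\<lambda>n. f' (t - \<sigma> n)) \<longlonglongrightarrow> f t)"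

lemma almost_automorphic_iff:
  "almost_automorphic f \<longleftrightarrow>
     bounded (range f) \<and> continuous_on UNIV f \<and>
     (\<forall>\<sigma> :: nat \<Rightarrow> real. \<exists>r f'. strict_mono r \<and> aa_along f (\<sigma> \<circ> r) f')"
  by (simp add: almost_automorphic_def aa_along_def Let_def)

lemma almost_automorphicE:
  assumes "almost_automorphic f"
  obtains r f' where "strict_mono (r :: nat \<Rightarrow> nat)" "aa_along f (\<sigma> \<circ> r) f'"
  using assms unfolding almost_automorphic_iff by metis

lemma aa_along_subseq:
  assumes "aa_along f \<sigma> f'" "strict_mono r"
  shows "aa_along f (\<sigma> \<circ> r) f'"
  unfolding aa_along_def
proof (intro conjI allI)
  fix t
  have "(\<lambda>n. f (t + \<sigma> n)) \<longlonglongrightarrow> f' t" "(\<lambda>n. f' (t - \<sigma> n)) \<longlonglongrightarrow> f t"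
    using assms(1) unfolding aa_along_def by auto
  from this[THEN LIMSEQ_subseq_LIMSEQ, OF assms(2)]
  show "(\<lambda>n. f (t + (\<sigma> \<circ> r) n)) \<longlonglongrightarrow> f' t" "(\<lambda>n. f' (t - (\<sigma> \<circ> r) n)) \<longlonglongrightarrow> f t"
    by (simp_all add: o_def)
qed

lemma tendsto_dist_zero_transform:
  fixes f g :: "nat \<Rightarrow> 'a::metric_space"
  assumes "f \<longlonglongrightarrow> l" "(\<lambda>n. dist (f n) (g n)) \<longlonglongrightarrow> 0"
  shows "g \<longlonglongrightarrow> l"
proof -
  have "(\<lambda>n. dist (f n) (g n) + dist (f n) l) \<longlonglongrightarrow> 0"
    using assms(2) tendsto_dist_iff[THEN iffD1, OF assms(1)] by (rule tendsto_add_zero)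
  then have "(\<lambda>n. dist (g n) l) \<longlonglongrightarrow> 0"
    by (rule Lim_null_comparison[rotated]) (simp add: dist_triangle3)
  then show ?thesis by (rule tendsto_dist_iff[THEN iffD2])
qed

text \<open>The distance from \<open>F n (p n)\<close> to \<open>g q\<close> splits at
  \<open>g (p n)\<close>: uniformity controls the first part, continuity of \<open>g\<close> the
  second. This is how an almost automorphic argument is substituted into \<open>f\<close> and into
  the kernels.\<close>

lemma uniform_limit_tendsto_along:
  fixes F :: "nat \<Rightarrow> 'a::metric_space \<Rightarrow> 'b::metric_space"
  assumes "uniform_limit B F g sequentially" "continuous_on B g"
    and "\<And>n. p n \<in> B" "q \<in> B" "p \<longlonglongrightarrow> q"
  shows "(\<lambda>n. F n (p n)) \<longlonglongrightarrow> g q"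
proof -
  have "(\<lambda>n. g (p n)) \<longlonglongrightarrow> g q"
    by (rule continuous_on_tendsto_compose[OF assms(2,5,4)]) (simp add: assms(3))
  moreover have "(\<lambda>n. dist (g (p n)) (F n (p n))) \<longlonglongrightarrow> 0"
  proof (rule LIMSEQ_I)
    fix e :: real assume "0 < e"
    with assms(1) have "\<forall>\<^sub>F n in sequentially. \<forall>x\<in>B. dist (F n x) (g x) < e"
      by (rule uniform_limitD)
    then show "\<exists>N. \<forall>n\<ge>N. norm (dist (g (p n)) (F n (p n)) - 0) < e"
      using assms(3) by (auto simp: eventually_sequentially dist_commute)
  qed
  ultimately show ?thesis
    by (rule tendsto_dist_zero_transform)
qed

text \<open>Keeps the limit function of \<open>p\<close> inside \<open>closure (range p)\<close>,
  the bounded set on which the uniform limits of \<open>f\<close> and of the kernels are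
  taken.\<close>

lemma aa_along_in_closed:
  assumes "aa_along f \<sigma> f'" "closed B" "range f \<subseteq> B"
  shows "f' t \<in> B"
proof (rule closed_sequentially)
  show "(\<lambda>n. f (t + \<sigma> n)) \<longlonglongrightarrow> f' t" using assms(1) unfolding aa_along_def by auto
qed (use assms in auto)

text \<open>A point of the closure is replaced by a value \<open>f (\<sigma> n)\<close> with error
  below 1/(n+1). The times \<open>\<sigma> n\<close> then serve as the shifts, and the limit at
  \<open>t = 0\<close> is the required cluster point.\<close>

lemma almost_automorphic_relatively_compact:
  assumes "almost_automorphic f"
  shows "compact (closure (range f))"
  unfolding compact_eq_seq_compact_metric seq_compact_def
proof (intro allI impI)
  fix x :: "nat \<Rightarrow> 'a" assume x: "\<forall>n. x n \<in> closure (range f)"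
  have "\<exists>t. dist (f t) (x n) < inverse (real (Suc n))" for n
    using x closure_approachable[of "x n" "range f"] by auto
  then obtain \<sigma> where \<sigma>: "\<And>n. dist (f (\<sigma> n)) (x n) < inverse (real (Suc n))" by metis
  obtain r f' where r: "strict_mono (r :: nat \<Rightarrow> nat)" "aa_along f (\<sigma> \<circ> r) f'"
    using assms by (rule almost_automorphicE)
  have "(\<lambda>n. f (0 + (\<sigma> \<circ> r) n)) \<longlonglongrightarrow> f' 0"
    using r(2) unfolding aa_along_def by metis
  then have f: "(\<lambda>n. f (\<sigma> (r n))) \<longlonglongrightarrow> f' 0" by simp
  have "(\<lambda>n. dist (f (\<sigma> n)) (x n)) \<longlonglongrightarrow> 0"
    by (rule tendsto_sandwich[OF _ _ tendsto_const LIMSEQ_inverse_real_of_nat])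
      (use \<sigma> in \<open>auto intro!: always_eventually less_imp_le\<close>)
  from LIMSEQ_subseq_LIMSEQ[OF this r(1)]
  have "(\<lambda>n. dist (f (\<sigma> (r n))) (x (r n))) \<longlonglongrightarrow> 0" by (simp add: o_def)
  with f have lim: "(\<lambda>n. x (r n)) \<longlonglongrightarrow> f' 0"
    by (rule tendsto_dist_zero_transform)
  moreover have "f' 0 \<in> closure (range f)"
    by (rule closed_sequentially[OF closed_closure _ lim]) (use x in auto)
  ultimately show "\<exists>l\<in>closure (range f). \<exists>r. strict_mono r \<and> (x \<circ> r) \<longlonglongrightarrow> l"
    using r(1) by (auto simp: o_def)
qed

text \<open>Both limits are pointwise, so continuity of \<open>y\<close> at the single points
  \<open>a' t\<close> and \<open>a t\<close> suffices. Besides the delays this yields constants and,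
  through pairs, sums.\<close>

lemma almost_automorphic_compose:
  assumes "almost_automorphic a" "continuous_on UNIV y" "bounded (range (\<lambda>t. y (a t)))"
  shows "almost_automorphic (\<lambda>t. y (a t))"
  unfolding almost_automorphic_iff
proof (intro conjI allI)
  show "bounded (range (\<lambda>t. y (a t)))" by (rule assms(3))
  show "continuous_on UNIV (\<lambda>t. y (a t))"
    by (rule continuous_on_compose2[OF assms(2)]) (use assms(1) in \<open>simp_all add: almost_automorphic_iff\<close>)
  fix \<sigma> :: "nat \<Rightarrow> real"
  obtain r a' where r: "strict_mono (r :: nat \<Rightarrow> nat)" "aa_along a (\<sigma> \<circ> r) a'"
    using assms(1) by (rule almost_automorphicE)
  have "aa_along (\<lambda>t. y (a t)) (\<sigma> \<circ> r) (\<lambda>t. y (a' t))"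
    unfolding aa_along_def
  proof (intro conjI allI)
    fix t
    show "(\<lambda>n. y (a (t + (\<sigma> \<circ> r) n))) \<longlonglongrightarrow> y (a' t)"
      by (rule continuous_on_tendsto_compose[OF assms(2)])
        (use r(2) in \<open>simp_all add: aa_along_def\<close>)
    show "(\<lambda>n. y (a' (t - (\<sigma> \<circ> r) n))) \<longlonglongrightarrow> y (a t)"
      by (rule continuous_on_tendsto_compose[OF assms(2)])
        (use r(2) in \<open>simp_all add: aa_along_def\<close>)
  qed
  with r(1) show "\<exists>r f'. strict_mono r \<and> aa_along (\<lambda>t. y (a t)) (\<sigma> \<circ> r) f'" by blast
qed

lemma almost_automorphic_Pair:
  assumes "almost_automorphic f" "almost_automorphic g"
  shows "almost_automorphic (\<lambda>t. (f t, g t))"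
  unfolding almost_automorphic_iff
proof (intro conjI allI)
  have "bounded (range f \<times> range g)"
    using assms by (intro bounded_Times) (simp_all add: almost_automorphic_iff)
  then show "bounded (range (\<lambda>t. (f t, g t)))"
    by (rule bounded_subset) auto
  show "continuous_on UNIV (\<lambda>t. (f t, g t))"
    using assms by (intro continuous_intros) (simp_all add: almost_automorphic_iff)
  fix \<sigma> :: "nat \<Rightarrow> real"
  obtain r f' where r: "strict_mono (r :: nat \<Rightarrow> nat)" "aa_along f (\<sigma> \<circ> r) f'"
    using assms(1) by (rule almost_automorphicE)
  obtain q g' where q: "strict_mono (q :: nat \<Rightarrow> nat)" "aa_along g ((\<sigma> \<circ> r) \<circ> q) g'"
    using assms(2) by (rule almost_automorphicE)
  have "aa_along (\<lambda>t. (f t, g t)) (\<sigma> \<circ> (r \<circ> q)) (\<lambda>t. (f' t, g' t))"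
    using aa_along_subseq[OF r(2) q(1)] q(2) unfolding aa_along_def o_assoc
    by (intro conjI allI tendsto_Pair) simp_all
  with strict_mono_o[OF r(1) q(1)]
  show "\<exists>r f'. strict_mono r \<and> aa_along (\<lambda>t. (f t, g t)) (\<sigma> \<circ> r) f'" by blast
qed

text \<open>On \<open>closure (range p)\<close> the convergence of \<open>f\<close> is uniform, so
  the second argument may vary with \<open>n\<close>. The limit \<open>f' t\<close> is continuous
  there as a uniform limit of continuous functions, which makes the substitution work in both
  directions.\<close>

lemma almost_automorphic_param_compose:
  assumes f: "almost_automorphic_param f" and p: "almost_automorphic p"
  shows "almost_automorphic (\<lambda>t. f t (p t))"
  unfolding almost_automorphic_iff
proof (intro conjI allI)
  have cf: "continuous_on UNIV (\<lambda>(t, p). f t p)"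
    and bf: "bounded (range (\<lambda>(t, p). f t p))"
    using f unfolding almost_automorphic_param_def by auto
  have cp: "continuous_on UNIV p" and bp: "bounded (range p)"
    using p unfolding almost_automorphic_iff by auto
  show "bounded (range (\<lambda>t. f t (p t)))"
    using bf by (rule bounded_subset) auto
  show "continuous_on UNIV (\<lambda>t. f t (p t))"
    using continuous_on_compose2[OF cf continuous_on_Pair[OF continuous_on_id cp]] by simp
  have cft: "continuous_on B (f t)" for B t
    using continuous_on_compose2[OF cf continuous_on_Pair[OF continuous_on_const continuous_on_id]]
    by simp
  fix \<sigma> :: "nat \<Rightarrow> real"
  let ?B = "closure (range p)"
  have B: "bounded ?B" using bp by (rule bounded_closure)
  obtain r p' where r: "strict_mono (r :: nat \<Rightarrow> nat)" "aa_along p (\<sigma> \<circ> r) p'"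
    using p by (rule almost_automorphicE)
  obtain q f' where q: "strict_mono (q :: nat \<Rightarrow> nat)"
    and f1: "\<And>t. uniform_limit ?B (\<lambda>n. f (t + (\<sigma> \<circ> r \<circ> q) n)) (f' t) sequentially"
    and f2: "\<And>t. uniform_limit ?B (\<lambda>n. f' (t - (\<sigma> \<circ> r \<circ> q) n)) (f t) sequentially"
    using f B unfolding almost_automorphic_param_def Let_def by meson
  have p1: "aa_along p (\<sigma> \<circ> r \<circ> q) p'" using aa_along_subseq[OF r(2) q(1)] .
  have pB: "p t \<in> ?B" for t by (rule closure_subset[THEN subsetD]) simp
  have p'B: "p' t \<in> ?B" for t
    by (rule aa_along_in_closed[OF p1]) (simp_all add: closure_subset)
  have cf': "continuous_on ?B (f' t)" for t
    by (rule uniform_limit_theorem[OF _ f1]) (auto simp: cft)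
  have "aa_along (\<lambda>t. f t (p t)) (\<sigma> \<circ> (r \<circ> q)) (\<lambda>t. f' t (p' t))"
    unfolding aa_along_def o_assoc
  proof (intro conjI allI)
    fix t
    show "(\<lambda>n. f (t + (\<sigma> \<circ> r \<circ> q) n) (p (t + (\<sigma> \<circ> r \<circ> q) n))) \<longlonglongrightarrow> f' t (p' t)"
      by (rule uniform_limit_tendsto_along[OF f1 cf' pB p'B]) (use p1 in \<open>simp add: aa_along_def\<close>)
    show "(\<lambda>n. f' (t - (\<sigma> \<circ> r \<circ> q) n) (p' (t - (\<sigma> \<circ> r \<circ> q) n))) \<longlonglongrightarrow> f t (p t)"
      by (rule uniform_limit_tendsto_along[OF f2 cft p'B pB]) (use p1 in \<open>simp add: aa_along_def\<close>)
  qed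
  with strict_mono_o[OF r(1) q(1)]
  show "\<exists>r f'. strict_mono r \<and> aa_along (\<lambda>t. f t (p t)) (\<sigma> \<circ> r) f'" by blast
qed

text \<open>One diagonal subsequence serves all \<open>u k\<close> at once. The limit functions
  \<open>u' k\<close> converge uniformly to some \<open>y'\<close>, and exchanging the limits in
  \<open>k\<close> and \<open>n\<close> shows that \<open>y'\<close> is a limit function of
  \<open>y\<close>.\<close>

lemma almost_automorphic_uniform_limit:
  fixes u :: "nat \<Rightarrow> real \<Rightarrow> 'a::banach"
  assumes u: "\<And>k. almost_automorphic (u k)" and lim: "uniform_limit UNIV u y sequentially"
  shows "almost_automorphic y"
  unfolding almost_automorphic_iff
proof (intro conjI allI)
  show "bounded (range y)"
  proof -
    obtain k where k: "\<And>t. dist (u k t) (y t) < 1"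
      using uniform_limitD[OF lim, of 1] by (auto simp: eventually_sequentially)
    obtain R where R: "\<And>t. norm (u k t) \<le> R"
      using u[of k] by (auto simp: almost_automorphic_iff bounded_iff)
    have "norm (y t) \<le> R + 1" for t
      using k[of t] R[of t] norm_triangle_sub[of "y t" "u k t"]
      by (simp add: dist_norm norm_minus_commute)
    then show ?thesis by (auto simp: bounded_iff)
  qed
  show "continuous_on UNIV y"
    by (rule uniform_limit_theorem[OF _ lim]) (use u in \<open>auto simp: almost_automorphic_iff\<close>)
  fix \<sigma> :: "nat \<Rightarrow> real"
  define P where "P k s \<longleftrightarrow> (\<exists>u'. aa_along (u k) (\<sigma> \<circ> s) u')" for k :: nat and s :: "nat \<Rightarrow> nat"
  interpret subseqs P
  proof
    fix n and s :: "nat \<Rightarrow> nat"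
    show "\<exists>r. strict_mono r \<and> P n (s \<circ> r)"
      using almost_automorphicE[OF u, of n "\<sigma> \<circ> s"] unfolding P_def o_assoc by metis
  qed
  \<comment> \<open>The diagonal sequence is a subsequence of the selection made for
    \<open>u k\<close> only after its first \<open>Suc k\<close> terms are dropped.\<close>
  have "P k (diagseq \<circ> ((+) (Suc k)))" for k
  proof (rule diagseq_holds)
    fix r s :: "nat \<Rightarrow> nat" and n
    assume r: "strict_mono r" and "P n s"
    then obtain v where "aa_along (u n) (\<sigma> \<circ> s) v" unfolding P_def by blast
    from aa_along_subseq[OF this r] show "P n (s \<circ> r)" unfolding P_def o_assoc by blast
  qed
  then have "\<exists>v. aa_along (u k) (\<sigma> \<circ> (diagseq \<circ> ((+) (Suc k)))) v" for k
    unfolding P_def .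
  then have "\<forall>k. \<exists>v. aa_along (u k) (\<sigma> \<circ> (diagseq \<circ> ((+) (Suc k)))) v" ..
  from choice[OF this]
  obtain u' where u': "\<And>k. aa_along (u k) (\<sigma> \<circ> (diagseq \<circ> ((+) (Suc k)))) (u' k)" by auto
  \<comment> \<open>Shifting the index by \<open>Suc k\<close> does not change a limit, so each
    \<open>u k\<close> converges along the whole diagonal sequence.\<close>
  have u1: "(\<lambda>n. u k (t + (\<sigma> \<circ> diagseq) n)) \<longlonglongrightarrow> u' k t" for k t
    by (rule LIMSEQ_offset[of _ "Suc k"])
      (use u'[of k] in \<open>simp add: aa_along_def o_def add.commute[of _ "Suc k"] del: add_Suc add_Suc_right\<close>)
  have u2: "(\<lambda>n. u' k (t - (\<sigma> \<circ> diagseq) n)) \<longlonglongrightarrow> u k t" for k t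
    by (rule LIMSEQ_offset[of _ "Suc k"])
      (use u'[of k] in \<open>simp add: aa_along_def o_def add.commute[of _ "Suc k"] del: add_Suc add_Suc_right\<close>)
  \<comment> \<open>Distances between the \<open>u' k\<close> are limits of distances between
    shifted values of the \<open>u k\<close>. The bound \<open>e / 2\<close> makes up for the loss
    of strictness in the limit.\<close>
  have "uniformly_Cauchy_on UNIV u'"
  proof (rule uniformly_Cauchy_onI)
    fix e :: real assume e: "0 < e"
    have "uniformly_Cauchy_on UNIV u"
      by (rule uniformly_convergent_Cauchy[OF uniformly_convergentI[OF lim]])
    then obtain M where M: "\<And>t m n. m \<ge> M \<Longrightarrow> n \<ge> M \<Longrightarrow> dist (u m t) (u n t) < e / 2"
      using e unfolding uniformly_Cauchy_on_def by (metis UNIV_I half_gt_zero)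
    have "dist (u' m t) (u' n t) < e" if "m \<ge> M" "n \<ge> M" for m n t
    proof -
      have "dist (u' m t) (u' n t) \<le> e / 2"
        by (rule LIMSEQ_le_const2[OF tendsto_dist[OF u1 u1]])
          (use M[OF that] in \<open>auto intro: less_imp_le\<close>)
      with e show ?thesis by simp
    qed
    then show "\<exists>M. \<forall>t\<in>UNIV. \<forall>m\<ge>M. \<forall>n\<ge>M. dist (u' m t) (u' n t) < e" by blast
  qed
  then obtain y' where y': "uniform_limit UNIV u' y' sequentially"
    using Cauchy_uniformly_convergent unfolding uniformly_convergent_on_def by metis
  have "aa_along y (\<sigma> \<circ> diagseq) y'"
    unfolding aa_along_def
  proof (intro conjI allI)
    fix t
    \<comment> \<open>Uniformity in \<open>t\<close> becomes uniformity in \<open>n\<close> along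
      any sequence of times, which is the condition for exchanging the two limits.\<close>
    have ul: "uniform_limit UNIV (\<lambda>k n. u k (\<tau> n)) (\<lambda>n. y (\<tau> n)) sequentially" for \<tau> :: "nat \<Rightarrow> real"
      using lim unfolding uniform_limit_iff by (auto elim!: eventually_mono)
    have ul': "uniform_limit UNIV (\<lambda>k n. u' k (\<tau> n)) (\<lambda>n. y' (\<tau> n)) sequentially" for \<tau> :: "nat \<Rightarrow> real"
      using y' unfolding uniform_limit_iff by (auto elim!: eventually_mono)
    show "(\<lambda>n. y (t + (\<sigma> \<circ> diagseq) n)) \<longlonglongrightarrow> y' t"
      by (rule swap_uniform_limit'[OF _ tendsto_uniform_limitI[OF y'] ul])
        (use u1 in auto)
    show "(\<lambda>n. y' (t - (\<sigma> \<circ> diagseq) n)) \<longlonglongrightarrow> y t"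
      by (rule swap_uniform_limit'[OF _ tendsto_uniform_limitI[OF lim] ul'])
        (use u2 in auto)
  qed
  with subseq_diagseq show "\<exists>r f'. strict_mono r \<and> aa_along y (\<sigma> \<circ> r) f'" by blast
qed

section \<open>Dominated convergence and translation for Banach-valued integrals\<close>

text \<open>The set \<open>D\<close> meets each compact interval in a compact interval, where
  continuity gives integrability; the dominating function carries this over to all of
  \<open>D\<close>.\<close>

lemma integrable_continuous_dominated:
  fixes g :: "real \<Rightarrow> 'a::banach"
  assumes D: "closed D" "is_interval D" and g: "continuous_on D g"
    and bound: "\<And>s. s \<in> D \<Longrightarrow> norm (g s) \<le> \<Lambda> s" and \<Lambda>: "\<Lambda> integrable_on D"
  shows "g integrable_on D"
proof (rule integrable_on_all_intervals_integrable_bound[OF _ bound \<Lambda>])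
  fix a b :: real
  have "compact (D \<inter> {a..b})" "connected (D \<inter> {a..b})"
    using D by (auto intro!: is_interval_connected is_interval_Int closed_Int_compact)
  then obtain c d where cd: "D \<inter> {a..b} = {c..d}"
    using connected_compact_interval_1 by blast
  have "g integrable_on {c..d}"
    by (rule integrable_continuous_real, rule continuous_on_subset[OF g]) (use cd in auto)
  then show "(\<lambda>x. if x \<in> D then g x else 0) integrable_on cbox a b"
    using cd by (simp add: integrable_restrict_Int)
qed

text \<open>
  The library's dominated convergence theorem is only available for finite-dimensional codomains.
  For Banach-valued integrands the theorem is applied to the norms of differences, and no
  integrability of the limit \<open>G\<close> is claimed: \<open>L\<close> plays the role of its integral.
\<close>

lemma dominated_norm_diff:
  fixes F :: "nat \<Rightarrow> real \<Rightarrow> 'a::banach"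
  assumes D: "closed D" "is_interval D" and F: "\<And>n. continuous_on D (F n)"
    and bF: "\<And>n s. s \<in> D \<Longrightarrow> norm (F n s) \<le> \<Lambda> s" and \<Lambda>: "\<Lambda> integrable_on D"
    and lim: "\<And>s. s \<in> D \<Longrightarrow> (\<lambda>n. F n s) \<longlonglongrightarrow> G s"
    and g: "continuous_on D g" and bg: "\<And>s. s \<in> D \<Longrightarrow> norm (g s) \<le> \<Lambda> s"
  shows "(\<lambda>s. norm (G s - g s)) integrable_on D"
    and "(\<lambda>n. integral D (\<lambda>s. norm (F n s - g s))) \<longlonglongrightarrow> integral D (\<lambda>s. norm (G s - g s))"
proof -
  have 2: "(\<lambda>s. 2 * \<Lambda> s) integrable_on D"
    using \<Lambda> by (rule integrable_on_mult_right)
  have b: "norm (norm (F n s - g s)) \<le> 2 * \<Lambda> s" if "s \<in> D" for n s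
    using bF[OF that, of n] bg[OF that] norm_triangle_ineq4[of "F n s" "g s"] by simp
  have i: "(\<lambda>s. norm (F n s - g s)) integrable_on D" for n
    by (rule integrable_continuous_dominated[OF D _ b 2]) (intro continuous_intros F g)
  have l: "(\<lambda>n. norm (F n s - g s)) \<longlonglongrightarrow> norm (G s - g s)" if "s \<in> D" for s
    by (intro tendsto_intros lim that)
  show "(\<lambda>s. norm (G s - g s)) integrable_on D"
    "(\<lambda>n. integral D (\<lambda>s. norm (F n s - g s))) \<longlonglongrightarrow> integral D (\<lambda>s. norm (G s - g s))"
    using dominated_convergence[OF i 2 b l] by auto
qed

text \<open>The integrals of the \<open>F n\<close> are Cauchy because the integrals of
  \<open>norm (G s - F n s)\<close> tend to 0. The inequality identifies \<open>L\<close> as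
  \<open>integral D g\<close> when \<open>G\<close> agrees with \<open>g\<close> on
  \<open>D\<close>, and otherwise measures how far \<open>L\<close> is from that integral.\<close>

lemma dominated_integral_limit:
  fixes F :: "nat \<Rightarrow> real \<Rightarrow> 'a::banach"
  assumes D: "closed D" "is_interval D" and F: "\<And>n. continuous_on D (F n)"
    and bF: "\<And>n s. s \<in> D \<Longrightarrow> norm (F n s) \<le> \<Lambda> s" and \<Lambda>: "\<Lambda> integrable_on D"
    and lim: "\<And>s. s \<in> D \<Longrightarrow> (\<lambda>n. F n s) \<longlonglongrightarrow> G s"
  obtains L where "(\<lambda>n. integral D (F n)) \<longlonglongrightarrow> L"
    and "\<And>g. continuous_on D g \<Longrightarrow> (\<And>s. s \<in> D \<Longrightarrow> norm (g s) \<le> \<Lambda> s) \<Longrightarrow>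
           norm (L - integral D g) \<le> integral D (\<lambda>s. norm (G s - g s))"
proof -
  have nd: "(\<lambda>s. norm (G s - g s)) integrable_on D"
    "(\<lambda>n. integral D (\<lambda>s. norm (F n s - g s))) \<longlonglongrightarrow> integral D (\<lambda>s. norm (G s - g s))"
    if "continuous_on D g" "\<And>s. s \<in> D \<Longrightarrow> norm (g s) \<le> \<Lambda> s" for g
    by (rule dominated_norm_diff[OF D, where F = F and \<Lambda> = \<Lambda>];
        (assumption | rule F bF \<Lambda> lim that)+)+
  have int: "g integrable_on D"
    if "continuous_on D g" "\<And>s. s \<in> D \<Longrightarrow> norm (g s) \<le> \<Lambda> s" for g :: "real \<Rightarrow> 'a"
    by (rule integrable_continuous_dominated[OF D that \<Lambda>])
  have 2: "(\<lambda>s. 2 * \<Lambda> s) integrable_on D"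
    using \<Lambda> by (rule integrable_on_mult_right)
  have diff: "norm (integral D (F n) - integral D g) \<le> integral D (\<lambda>s. norm (F n s - g s))"
    if g: "continuous_on D g" "\<And>s. s \<in> D \<Longrightarrow> norm (g s) \<le> \<Lambda> s" for n and g :: "real \<Rightarrow> 'a"
  proof -
    have b: "norm (norm (F n s - g s)) \<le> 2 * \<Lambda> s" if "s \<in> D" for s
      using bF[OF that, of n] g(2)[OF that] norm_triangle_ineq4[of "F n s" "g s"] by simp
    have "(\<lambda>s. norm (F n s - g s)) integrable_on D"
      by (rule integrable_continuous_dominated[OF D _ b 2]) (intro continuous_intros F g)
    then have "norm (integral D (\<lambda>s. F n s - g s)) \<le> integral D (\<lambda>s. norm (F n s - g s))"
      by (intro integral_norm_bound_integral integrable_diff int F bF g) auto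
    then show ?thesis by (simp add: integral_diff int F bF g)
  qed
  have bG: "norm (G s) \<le> \<Lambda> s" if "s \<in> D" for s
    by (rule LIMSEQ_le_const2[OF tendsto_norm[OF lim[OF that]]]) (use bF that in auto)
  \<comment> \<open>Each \<open>F n\<close> is itself continuous and dominated, so it may take the
    place of the comparison function \<open>g\<close> in \<open>nd\<close>.\<close>
  have h0: "(\<lambda>n. integral D (\<lambda>s. norm (G s - F n s))) \<longlonglongrightarrow> integral D (\<lambda>s. 0)"
  proof (rule dominated_convergence(2)[OF nd(1)[OF F bF] 2])
    show "norm (norm (G s - F n s)) \<le> 2 * \<Lambda> s" if "s \<in> D" for n s
      using bF[OF that, of n] bG[OF that] norm_triangle_ineq4[of "G s" "F n s"] by simp
    show "(\<lambda>n. norm (G s - F n s)) \<longlonglongrightarrow> 0" if "s \<in> D" for s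
      using tendsto_norm[OF tendsto_diff[OF tendsto_const[of "G s"] lim[OF that]]] by simp
  qed
  \<comment> \<open>The triangle inequality passes through \<open>G\<close> under the norm, so only
    scalar integrals involve \<open>G\<close>.\<close>
  have le: "norm (integral D (F n) - integral D (F m))
      \<le> integral D (\<lambda>s. norm (G s - F n s)) + integral D (\<lambda>s. norm (G s - F m s))" for m n
  proof -
    have b: "norm (F n s - F m s) \<le> norm (G s - F n s) + norm (G s - F m s)" for s
      using norm_triangle_ineq4[of "G s - F m s" "G s - F n s"] by simp
    have "norm (integral D (\<lambda>s. F n s - F m s))
        \<le> integral D (\<lambda>s. norm (G s - F n s) + norm (G s - F m s))"
      by (rule integral_norm_bound_integral)
        (intro integrable_diff integrable_add int F bF nd(1) b; assumption)+
    then show ?thesis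
      by (simp add: integral_diff integral_add int F bF nd(1))
  qed
  have "Cauchy (\<lambda>n. integral D (F n))"
  proof (rule metric_CauchyI)
    fix e :: real assume "0 < e"
    then obtain N where N: "\<And>n. n \<ge> N \<Longrightarrow> norm (integral D (\<lambda>s. norm (G s - F n s))) < e / 2"
      using LIMSEQ_D[OF h0, of "e / 2"] by auto
    have "dist (integral D (F m)) (integral D (F n)) < e" if "m \<ge> N" "n \<ge> N" for m n
      using le[of m n] N[OF that(1)] N[OF that(2)] unfolding dist_norm by simp
    then show "\<exists>N. \<forall>m\<ge>N. \<forall>n\<ge>N. dist (integral D (F m)) (integral D (F n)) < e" by blast
  qed
  then obtain L where L: "(\<lambda>n. integral D (F n)) \<longlonglongrightarrow> L"
    using Cauchy_convergent_iff convergent_def by blast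
  show ?thesis
  proof (rule that[OF L])
    fix g :: "real \<Rightarrow> 'a" assume g: "continuous_on D g" "\<And>s. s \<in> D \<Longrightarrow> norm (g s) \<le> \<Lambda> s"
    show "norm (L - integral D g) \<le> integral D (\<lambda>s. norm (G s - g s))"
      by (rule LIMSEQ_le[OF tendsto_norm[OF tendsto_diff[OF L tendsto_const]] nd(2)[OF g]])
        (use diff[OF g] in auto)
  qed
qed

lemma integral_translation:
  fixes g :: "real \<Rightarrow> 'a::banach"
  assumes SD: "\<And>s. c + s \<in> S \<longleftrightarrow> s \<in> D"
  shows "integral D (\<lambda>s. g (c + s)) = integral S g"
    and "(\<lambda>s. g (c + s)) integrable_on D \<longleftrightarrow> g integrable_on S"
proof -
  have transl: "((\<lambda>s. g (c + s)) has_integral i) UNIV" if gi: "(g has_integral i) UNIV"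
    for g :: "real \<Rightarrow> 'a" and c i
  proof -
    \<comment> \<open>Since the line is not a bounded box, the integral over it is characterized by
      integrals over all sufficiently large boxes.\<close>
    have U: "\<not> (\<exists>a b. UNIV = cbox a (b::real))" by (metis bounded_cbox not_bounded_UNIV)
    have "\<exists>B>0. \<forall>a b. ball 0 B \<subseteq> cbox a b \<longrightarrow>
        (\<exists>z. ((\<lambda>s. if s \<in> UNIV then g (c + s) else 0) has_integral z) (cbox a b) \<and> norm (z - i) < e)"
      if e: "e > 0" for e
    proof -
      obtain B where B: "B > 0" "\<forall>a b. ball 0 B \<subseteq> cbox a b \<longrightarrow>
        (\<exists>z. ((\<lambda>s. if s \<in> UNIV then g s else 0) has_integral z) (cbox a b) \<and> norm (z - i) < e)"
        using has_integral_altD[OF gi U e] by blast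
      show ?thesis
      \<comment> \<open>A box containing the ball of radius \<open>B + \<bar>c\<bar>\<close> still
        contains the ball of radius \<open>B\<close> after translation by \<open>c\<close>.\<close>
      proof (intro exI[of _ "B + \<bar>c\<bar>"] conjI allI impI)
        show "0 < B + \<bar>c\<bar>" using B(1) by simp
        fix a b :: real assume ab: "ball 0 (B + \<bar>c\<bar>) \<subseteq> cbox a b"
        have "ball 0 B \<subseteq> cbox (a + c) (b + c)"
        proof
          fix x :: real assume "x \<in> ball 0 B"
          then have "x - c \<in> ball 0 (B + \<bar>c\<bar>)" by (auto simp: dist_norm)
          with ab have "x - c \<in> cbox a b" by blast
          then show "x \<in> cbox (a + c) (b + c)" by auto
        qed
        with B(2) obtain z where z: "(g has_integral z) (cbox (a + c) (b + c))" "norm (z - i) < e"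
          unfolding if_P[OF UNIV_I] by blast
        have "((\<lambda>s. g (s + c)) has_integral z) (cbox a b)"
          using has_integral_shift_cbox[OF z(1), of c] by simp
        with z(2) show "\<exists>z. ((\<lambda>s. if s \<in> UNIV then g (c + s) else 0) has_integral z) (cbox a b)
            \<and> norm (z - i) < e" by (auto simp: add.commute)
      qed
    qed
    then show ?thesis by (subst has_integral_alt) (use U in auto)
  qed
  \<comment> \<open>Extension by zero reduces the claim to the whole line; translating by
    \<open>c\<close> and by \<open>- c\<close> gives the two directions.\<close>
  let ?G = "\<lambda>s. if s \<in> S then g s else 0"
  have "(?G has_integral i) UNIV \<longleftrightarrow> ((\<lambda>s. ?G (c + s)) has_integral i) UNIV" for i
    using transl[of ?G i c] transl[of "\<lambda>s. ?G (c + s)" i "- c"] by auto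
  then have "((\<lambda>s. g (c + s)) has_integral i) D \<longleftrightarrow> (g has_integral i) S" for i
    by (simp add: SD has_integral_restrict_UNIV)
  then show "integral D (\<lambda>s. g (c + s)) = integral S g"
    and "(\<lambda>s. g (c + s)) integrable_on D \<longleftrightarrow> g integrable_on S"
    by (simp_all add: integral_def integrable_on_def)
qed

section \<open>Integral operators with bi-almost automorphic kernels\<close>

text \<open>The set \<open>S t\<close> is \<open>D\<close> translated by \<open>t\<close>; with
  \<open>D\<close> equal to \<open>{..0}\<close> or \<open>{0..}\<close> this covers both
  half-lines. The substitution makes the domain and the dominating function \<open>lam 0\<close>
  independent of \<open>t\<close>, and dominated convergence then handles the limits in both
  directions.\<close>

lemma almost_automorphic_kernel_integral:
  fixes p :: "real \<Rightarrow> 'x::banach \<times> 'x"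
  fixes S :: "real \<Rightarrow> real set"
  assumes C: "bi_almost_automorphic C" and lam: "lambda_bounded lam C"
    and D: "closed D" "is_interval D" and lamD: "lam 0 integrable_on D"
    and S: "\<And>t s. t + s \<in> S t \<longleftrightarrow> s \<in> D"
    and p: "almost_automorphic p"
  shows "(\<lambda>s. C t s (p s)) integrable_on S t"
    and "almost_automorphic (\<lambda>t. integral (S t) (\<lambda>s. C t s (p s)))"
proof -
  define H where "H t s = C t (t + s) (p (t + s))" for t s
  have cC: "continuous_on UNIV (\<lambda>(t, s, q). C t s q)"
    using C unfolding bi_almost_automorphic_def by auto
  have cp: "continuous_on UNIV p" and bp: "bounded (range p)"
    using p unfolding almost_automorphic_iff by auto
  \<comment> \<open>The bound is read off at the base point \<open>(0, s)\<close> with shift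
    \<open>t\<close>, for the one-point bounded set \<open>{p (t + s)}\<close>.\<close>
  have bH: "norm (H t s) \<le> lam 0 s" for t s
  proof -
    have "\<forall>t' s' \<tau>. \<forall>q\<in>{p (t + s)}. norm (C (t' + \<tau>) (s' + \<tau>) q) \<le> lam t' s'"
      using lam unfolding lambda_bounded_def by (meson finite_imp_bounded finite.intros)
    from this[rule_format, of _ 0 t s] show ?thesis by (simp add: H_def add.commute)
  qed
  have cH: "continuous_on UNIV (\<lambda>(t, s). H t s)"
  proof -
    have "continuous_on UNIV (\<lambda>z::real \<times> real. (fst z, fst z + snd z, p (fst z + snd z)))"
      by (intro continuous_intros continuous_on_compose2[OF cp]) auto
    from continuous_on_compose2[OF cC this] show ?thesis
      by (simp add: H_def case_prod_unfold)
  qed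
  have cHt: "continuous_on B (H t)" for B t
    using continuous_on_compose2[OF cH continuous_on_Pair[OF continuous_on_const continuous_on_id]]
    by simp
  have cCts: "continuous_on B (C t s)" for B t s
    using continuous_on_compose2[OF cC continuous_on_Pair[OF continuous_on_const
        continuous_on_Pair[OF continuous_on_const continuous_on_id]]] by simp
  note lim = dominated_integral_limit[OF D cHt bH lamD]
  have "almost_automorphic (\<lambda>t. integral D (H t))"
    unfolding almost_automorphic_iff
  proof (intro conjI allI)
    have "norm (integral D (H t)) \<le> integral D (lam 0)" for t
      by (intro integral_norm_bound_integral integrable_continuous_dominated[OF D cHt bH lamD] lamD bH)
    then show "bounded (range (\<lambda>t. integral D (H t)))" by (auto simp: bounded_iff)
    show "continuous_on UNIV (\<lambda>t. integral D (H t))"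
      unfolding continuous_on_sequentially
    proof (intro ballI allI impI)
      fix x :: "nat \<Rightarrow> real" and t assume x: "(\<forall>n. x n \<in> UNIV) \<and> x \<longlonglongrightarrow> t"
      have "(\<lambda>n. H (x n) s) \<longlonglongrightarrow> H t s" for s
        using continuous_on_tendsto_compose[OF cH tendsto_Pair[OF conjunct2[OF x] tendsto_const]]
        by simp
      \<comment> \<open>Here the pointwise limit is \<open>H t\<close>. Choosing it also as the
        comparison function makes the right-hand side vanish and identifies
        \<open>L\<close>.\<close>
      from lim[OF this] obtain L where L: "(\<lambda>n. integral D (H (x n))) \<longlonglongrightarrow> L"
        and "\<And>g. continuous_on D g \<Longrightarrow> (\<And>s. s \<in> D \<Longrightarrow> norm (g s) \<le> lam 0 s) \<Longrightarrow>
           norm (L - integral D g) \<le> integral D (\<lambda>s. norm (H t s - g s))" by blast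
      from this(2)[OF cHt bH, of t] have "L = integral D (H t)" by simp
      with L show "((\<lambda>t. integral D (H t)) \<circ> x) \<longlonglongrightarrow> integral D (H t)" by (simp add: o_def)
    qed
    fix \<sigma>' :: "nat \<Rightarrow> real"
    let ?B = "closure (range p)"
    have B: "bounded ?B" using bp by (rule bounded_closure)
    obtain r p' where r: "strict_mono (r :: nat \<Rightarrow> nat)" "aa_along p (\<sigma>' \<circ> r) p'"
      using p by (rule almost_automorphicE)
    obtain q C' where q: "strict_mono (q :: nat \<Rightarrow> nat)"
      and C': "bi_limit_function C ?B (\<sigma>' \<circ> r \<circ> q) C'"
      using C B unfolding bi_almost_automorphic_def by meson
    define \<sigma> where "\<sigma> = \<sigma>' \<circ> r \<circ> q"
    have C1: "uniform_limit ?B (\<lambda>n. C (t + \<sigma> n) (s + \<sigma> n)) (C' t s) sequentially"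
      and C2: "uniform_limit ?B (\<lambda>n. C' (t - \<sigma> n) (s - \<sigma> n)) (C t s) sequentially" for t s
      using C' unfolding bi_limit_function_def \<sigma>_def by auto
    have p1: "aa_along p \<sigma> p'" using aa_along_subseq[OF r(2) q(1)] unfolding \<sigma>_def .
    have pB: "p t \<in> ?B" for t by (rule closure_subset[THEN subsetD]) simp
    have p'B: "p' t \<in> ?B" for t
      by (rule aa_along_in_closed[OF p1]) (simp_all add: closure_subset)
    have cC': "continuous_on ?B (C' t s)" for t s
      by (rule uniform_limit_theorem[OF _ C1]) (auto simp: cCts)
    define H' where "H' t s = C' t (t + s) (p' (t + s))" for t s
    have H1: "(\<lambda>n. H (t + \<sigma> n) s) \<longlonglongrightarrow> H' t s" for t s
    proof -
      have "(\<lambda>n. C (t + \<sigma> n) (t + s + \<sigma> n) (p (t + s + \<sigma> n))) \<longlonglongrightarrow> C' t (t + s) (p' (t + s))"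
        by (rule uniform_limit_tendsto_along[OF C1 cC' pB p'B]) (use p1 in \<open>simp add: aa_along_def\<close>)
      then show ?thesis by (simp add: H_def H'_def algebra_simps)
    qed
    have H2: "(\<lambda>n. H' (t - \<sigma> n) s) \<longlonglongrightarrow> H t s" for t s
    proof -
      have "(\<lambda>n. C' (t - \<sigma> n) (t + s - \<sigma> n) (p' (t + s - \<sigma> n))) \<longlonglongrightarrow> C t (t + s) (p (t + s))"
        by (rule uniform_limit_tendsto_along[OF C2 cCts p'B pB]) (use p1 in \<open>simp add: aa_along_def\<close>)
      then show ?thesis by (simp add: H_def H'_def algebra_simps)
    qed
    have bH': "norm (H' t s) \<le> lam 0 s" for t s
      by (rule LIMSEQ_le_const2[OF tendsto_norm[OF H1]]) (use bH in auto)
    \<comment> \<open>\<open>J t\<close>, chosen below with \<open>Q t (J t)\<close>, stands in for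
      the integral of \<open>H' t\<close>. The comparison functions \<open>H v\<close> have an
      independent time \<open>v\<close>, so that \<open>v\<close> can stay fixed while
      \<open>t\<close> is shifted.\<close>
    define Q where "Q t L \<longleftrightarrow> (\<lambda>n. integral D (H (t + \<sigma> n))) \<longlonglongrightarrow> L \<and>
       (\<forall>v. norm (L - integral D (H v)) \<le> integral D (\<lambda>s. norm (H' t s - H v s)))" for t L
    have "\<exists>L. Q t L" for t
      unfolding Q_def
      by (rule lim[OF H1[of t]]) (use cHt bH in blast)
    then obtain J where "\<And>t. Q t (J t)" by metis
    then have J1: "(\<lambda>n. integral D (H (t + \<sigma> n))) \<longlonglongrightarrow> J t"
      and J2: "norm (J t - integral D (H v)) \<le> integral D (\<lambda>s. norm (H' t s - H v s))" for t v
      by (simp_all add: Q_def)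
    \<comment> \<open>\<open>J2\<close> at \<open>t - \<sigma> n\<close> with \<open>v = t\<close>
      bounds the error by a scalar integral, to which dominated convergence applies because of
      \<open>H2\<close>.\<close>
    have J3: "(\<lambda>n. J (t - \<sigma> n)) \<longlonglongrightarrow> integral D (H t)" for t
    proof -
      have 2: "(\<lambda>s. 2 * lam 0 s) integrable_on D"
        using lamD by (rule integrable_on_mult_right)
      have "(\<lambda>n. integral D (\<lambda>s. norm (H' (t - \<sigma> n) s - H t s))) \<longlonglongrightarrow> integral D (\<lambda>s. 0)"
      proof (rule dominated_convergence(2)[OF dominated_norm_diff(1)[OF D cHt bH lamD H1 cHt bH] 2])
        show "norm (norm (H' (t - \<sigma> n) s - H t s)) \<le> 2 * lam 0 s" for n s
          using bH[of t s] bH'[of "t - \<sigma> n" s] norm_triangle_ineq4[of "H' (t - \<sigma> n) s" "H t s"] by simp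
        show "(\<lambda>n. norm (H' (t - \<sigma> n) s - H t s)) \<longlonglongrightarrow> 0" for s
          using tendsto_norm[OF tendsto_diff[OF H2[of t s] tendsto_const[of "H t s"]]] by simp
      qed
      then have "(\<lambda>n. integral D (\<lambda>s. norm (H' (t - \<sigma> n) s - H t s))) \<longlonglongrightarrow> 0" by simp
      then have "(\<lambda>n. J (t - \<sigma> n) - integral D (H t)) \<longlonglongrightarrow> 0"
        by (rule Lim_null_comparison[rotated]) (use J2 in auto)
      then show ?thesis by (simp add: LIM_zero_iff)
    qed
    have "aa_along (\<lambda>t. integral D (H t)) (\<sigma>' \<circ> (r \<circ> q)) J"
      using J1 J3 unfolding aa_along_def by (auto simp: \<sigma>_def)
    with strict_mono_o[OF r(1) q(1)]
    show "\<exists>r f'. strict_mono r \<and> aa_along (\<lambda>t. integral D (H t)) (\<sigma>' \<circ> r) f'" by blast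
  qed
  moreover have "integral D (H t) = integral (S t) (\<lambda>s. C t s (p s))" for t
    unfolding H_def by (rule integral_translation(1)[OF S])
  ultimately show "almost_automorphic (\<lambda>t. integral (S t) (\<lambda>s. C t s (p s)))" by simp
  have "(\<lambda>s. C t (t + s) (p (t + s))) integrable_on D"
    using integrable_continuous_dominated[OF D cHt bH lamD] by (simp add: H_def)
  then show "(\<lambda>s. C t s (p s)) integrable_on S t"
    by (simp add: integral_translation(2)[OF S, where g = "\<lambda>s. C t s (p s)"])
qed

section \<open>Contraction estimate and approximation of the solution\<close>

text \<open>Both integrands carry the same second argument \<open>w\<close>, so the Lipschitz
  condition contributes the distance \<open>c\<close> once instead of twice.\<close>

lemma norm_kernel_integral_diff_le:
  fixes u v w :: "real \<Rightarrow> 'x::banach"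
  assumes C: "mu_lipschitz \<mu> \<mu>' C" and \<mu>: "\<mu> t integrable_on S"
    and "(\<lambda>s. C t s (u s, w s)) integrable_on S" "(\<lambda>s. C t s (v s, w s)) integrable_on S"
    and c: "\<And>s. norm (u s - v s) \<le> c"
  shows "norm (integral S (\<lambda>s. C t s (u s, w s)) - integral S (\<lambda>s. C t s (v s, w s)))
    \<le> integral S (\<mu> t) * c"
proof -
  have "norm (integral S (\<lambda>s. C t s (u s, w s) - C t s (v s, w s))) \<le> integral S (\<lambda>s. \<mu> t s * c)"
  proof (rule integral_norm_bound_integral)
    fix s
    have "pair_lipschitz_on (\<mu> t s) {(u s, w s), (v s, w s)} (C t s)"
      using C unfolding mu_lipschitz_def by (simp add: finite_imp_bounded)
    then have "norm (C t s (u s, w s) - C t s (v s, w s)) \<le> \<mu> t s * norm (u s - v s)"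
      by (simp add: pair_lipschitz_on_def)
    also have "\<dots> \<le> \<mu> t s * c"
      using C c[of s] unfolding mu_lipschitz_def by (intro mult_left_mono) simp_all
    finally show "norm (C t s (u s, w s) - C t s (v s, w s)) \<le> \<mu> t s * c" .
  qed (use assms in \<open>auto intro: integrable_diff integrable_on_mult_left\<close>)
  then show ?thesis using assms by (simp add: integral_diff)
qed

lemma solution_almost_automorphic:
  fixes C1 C2 :: "real \<Rightarrow> real \<Rightarrow> 'x::banach \<times> 'x \<Rightarrow> 'x"
    and y :: "real \<Rightarrow> 'x"
  assumes adm: "admissible_kernels C1 C2 \<mu>1 \<mu>2"
    and f: "almost_automorphic_param f"
    and Lf: "\<And>B t. bounded B \<Longrightarrow> pair_lipschitz_on L\<^sub>f B (f t)"
    and \<rho>: "L\<^sub>f + (SUP t. integral {..t} (\<mu>1 t) + integral {t..} (\<mu>2 t)) = \<rho>"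
    and \<rho>1: "\<rho> < 1"
    and a: "almost_automorphic a0" "almost_automorphic a1" "almost_automorphic a2"
    and y: "bounded (range y)" "continuous_on UNIV y"
    and sol: "solves_integral_equation f C1 C2 a0 a1 a2 y"
  shows "almost_automorphic y"
proof -
  have zero: "almost_automorphic (\<lambda>_. 0 :: 'x)"
    using almost_automorphic_compose[OF a(1), of "\<lambda>_. 0"] by simp
  show ?thesis
  proof (cases "L\<^sub>f < 0")
    \<comment> \<open>A negative Lipschitz constant forces the space to be trivial, as comparing
      \<open>(x, 0)\<close> with \<open>(0, 0)\<close> shows.\<close>
    case True
    have "x = 0" for x :: 'x
    proof -
      have "pair_lipschitz_on L\<^sub>f {(x, 0), (0, 0)} (f 0)"
        by (intro Lf finite_imp_bounded) auto
      then have "0 \<le> L\<^sub>f * norm x"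
        unfolding pair_lipschitz_on_def by (auto intro: order_trans[OF norm_ge_zero])
      with True show ?thesis by (simp add: zero_le_mult_iff)
    qed
    then have "y = (\<lambda>_. 0)" by blast
    then show ?thesis using zero by simp
  next
    case False
    define w0 where "w0 t = y (a0 t)" for t
    define w1 where "w1 t = y (a1 t)" for t
    define w2 where "w2 t = y (a2 t)" for t
    have bw: "bounded (range (\<lambda>t. y (a t)))" for a :: "real \<Rightarrow> real"
      by (rule bounded_subset[OF y(1)]) auto
    have w: "almost_automorphic w0" "almost_automorphic w1" "almost_automorphic w2"
      unfolding w0_def[abs_def] w1_def[abs_def] w2_def[abs_def]
      by (rule almost_automorphic_compose[OF _ y(2) bw], rule a)+
    define T where "T u t = f t (u t, w0 t) + integral {..t} (\<lambda>s. C1 t s (u s, w1 s))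
        + integral {t..} (\<lambda>s. C2 t s (u s, w2 s))" for u t
    obtain lam1 lam2 \<mu>1' \<mu>2'
      where C1: "bi_almost_automorphic C1" "lambda_bounded lam1 C1" "lam1 0 integrable_on {..0}"
          "mu_lipschitz \<mu>1 \<mu>1' C1"
        and C2: "bi_almost_automorphic C2" "lambda_bounded lam2 C2" "lam2 0 integrable_on {0..}"
          "mu_lipschitz \<mu>2 \<mu>2' C2"
        and \<mu>1: "bounded_left_integrals \<mu>1" and \<mu>2: "bounded_right_integrals \<mu>2"
      using adm unfolding admissible_kernels_def
      by (auto simp: bounded_left_integrals_def bounded_right_integrals_def)
    have I1: "(\<lambda>s. C1 t s (p s)) integrable_on {..t}"
      "almost_automorphic (\<lambda>t. integral {..t} (\<lambda>s. C1 t s (p s)))" if "almost_automorphic p" for p t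
      by (rule almost_automorphic_kernel_integral[OF C1(1,2) _ _ C1(3) _ that]; simp add: is_interval_ic)+
    have I2: "(\<lambda>s. C2 t s (p s)) integrable_on {t..}"
      "almost_automorphic (\<lambda>t. integral {t..} (\<lambda>s. C2 t s (p s)))" if "almost_automorphic p" for p t
      by (rule almost_automorphic_kernel_integral[OF C2(1,2) _ _ C2(3) _ that]; simp add: is_interval_ci)+
    have add: "almost_automorphic (\<lambda>t. g t + h t)"
      if "almost_automorphic g" "almost_automorphic h" for g h :: "real \<Rightarrow> 'x"
    proof -
      have "bounded (range (\<lambda>t. g t + h t))"
        using that by (intro bounded_plus_comp) (simp_all add: almost_automorphic_iff)
      moreover have "continuous_on UNIV (\<lambda>z :: 'x \<times> 'x. fst z + snd z)"
        by (intro continuous_intros)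
      ultimately show ?thesis
        using almost_automorphic_compose[OF almost_automorphic_Pair[OF that],
            of "\<lambda>z. fst z + snd z"] by simp
    qed
    have T: "almost_automorphic (T u)" if "almost_automorphic u" for u
      unfolding T_def[abs_def]
      by (intro add almost_automorphic_param_compose[OF f] I1 I2 almost_automorphic_Pair that w)
    have y_eq: "T y t = y t"
      and y_int: "(\<lambda>s. C1 t s (y s, w1 s)) integrable_on {..t}"
        "(\<lambda>s. C2 t s (y s, w2 s)) integrable_on {t..}" for t
      using sol by (simp_all add: solves_integral_equation_def T_def w0_def w1_def w2_def)
    define M where "M t = integral {..t} (\<mu>1 t) + integral {t..} (\<mu>2 t)" for t
    have M: "L\<^sub>f + M t \<le> \<rho>" for t
    proof -
      \<comment> \<open>The supremum bounds each \<open>M t\<close> once the values are known to be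
        bounded above; the separate bounds for the two integrals provide this.\<close>
      obtain c d where "\<And>t. integral {..t} (\<mu>1 t) \<le> c" "\<And>t. integral {t..} (\<mu>2 t) \<le> d"
        using \<mu>1 \<mu>2 unfolding bounded_left_integrals_def bounded_right_integrals_def bdd_above_def
        by blast
      then have "bdd_above (range M)"
        unfolding M_def by (intro bdd_aboveI2[of _ _ "c + d"] add_mono)
      then have "M t \<le> (SUP t. M t)" by (rule cSUP_upper[rotated]) simp
      then show ?thesis using \<rho> by (simp add: M_def)
    qed
    \<comment> \<open>Nonnegativity of one value of \<open>M\<close>, together with that of
      \<open>L\<^sub>f\<close>, yields \<open>0 \<le> \<rho>\<close>, on which the convergence of
      \<open>\<rho> ^ n\<close> to 0 relies.\<close>
    have "0 \<le> integral {..0} (\<mu>1 0)" "0 \<le> integral {0..} (\<mu>2 0)"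
      using C1(4) C2(4) \<mu>1 \<mu>2
      by (simp_all add: mu_lipschitz_def bounded_left_integrals_def bounded_right_integrals_def
          integral_nonneg)
    then have "0 \<le> M 0" unfolding M_def by simp
    with M[of 0] False have \<rho>0: "0 \<le> \<rho>" by simp
    \<comment> \<open>Only distances to the fixed point \<open>y\<close> are estimated;
      \<open>c\<close> is any uniform bound on the distance before \<open>T\<close> is
      applied.\<close>
    have contraction: "norm (T u t - y t) \<le> \<rho> * c"
      if u: "almost_automorphic u" and c: "\<And>t. norm (u t - y t) \<le> c" for u c t
    proof -
      have c0: "0 \<le> c" using c[of 0] norm_ge_zero order_trans by blast
      have "pair_lipschitz_on L\<^sub>f {(u t, w0 t), (y t, w0 t)} (f t)"
        by (intro Lf finite_imp_bounded) auto
      then have "norm (f t (u t, w0 t) - f t (y t, w0 t)) \<le> L\<^sub>f * norm (u t - y t)"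
        by (simp add: pair_lipschitz_on_def)
      also have "\<dots> \<le> L\<^sub>f * c" using False c by (intro mult_left_mono) auto
      finally have 0: "norm (f t (u t, w0 t) - f t (y t, w0 t)) \<le> L\<^sub>f * c" .
      have 1: "norm (integral {..t} (\<lambda>s. C1 t s (u s, w1 s)) - integral {..t} (\<lambda>s. C1 t s (y s, w1 s)))
          \<le> integral {..t} (\<mu>1 t) * c"
        using \<mu>1 by (intro norm_kernel_integral_diff_le[OF C1(4)] I1 almost_automorphic_Pair u w y_int c)
          (auto simp: bounded_left_integrals_def)
      have 2: "norm (integral {t..} (\<lambda>s. C2 t s (u s, w2 s)) - integral {t..} (\<lambda>s. C2 t s (y s, w2 s)))
          \<le> integral {t..} (\<mu>2 t) * c"
        using \<mu>2 by (intro norm_kernel_integral_diff_le[OF C2(4)] I2 almost_automorphic_Pair u w y_int c)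
          (auto simp: bounded_right_integrals_def)
      have "norm (T u t - T y t) \<le> L\<^sub>f * c + integral {..t} (\<mu>1 t) * c + integral {t..} (\<mu>2 t) * c"
        unfolding T_def
        by (rule order_trans[OF norm_diff_triangle_ineq add_mono[OF
          order_trans[OF norm_diff_triangle_ineq add_mono[OF 0 1]] 2]])
      also have "\<dots> = (L\<^sub>f + M t) * c" by (simp add: M_def algebra_simps)
      also have "\<dots> \<le> \<rho> * c" using M c0 by (rule mult_right_mono)
      finally show ?thesis by (simp add: y_eq)
    qed
    \<comment> \<open>\<open>R\<close> bounds the initial error, because the iteration starts at the
      zero function.\<close>
    obtain R where R: "\<And>t. norm (y t) \<le> R" using y(1) by (auto simp: bounded_iff)
    define u where "u n = (T ^^ n) (\<lambda>_. 0)" for n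
    have u: "almost_automorphic (u n)" for n
      by (induction n) (auto simp: u_def zero intro: T)
    have uy: "norm (u n t - y t) \<le> \<rho> ^ n * R" for n t
    proof (induction n arbitrary: t)
      case 0
      show ?case by (simp add: u_def R)
    next
      case (Suc n)
      show ?case using contraction[OF u Suc] by (simp add: u_def mult.assoc)
    qed
    have "(\<lambda>n. \<rho> ^ n * R) \<longlonglongrightarrow> 0"
      using \<rho>0 \<rho>1 by (intro tendsto_mult_left_zero LIMSEQ_power_zero) auto
    have "uniform_limit UNIV u y sequentially"
    proof (rule uniform_limitI)
      fix e :: real assume "0 < e"
      with \<open>(\<lambda>n. \<rho> ^ n * R) \<longlonglongrightarrow> 0\<close> have "\<forall>\<^sub>F n in sequentially. \<rho> ^ n * R < e"
        by (rule order_tendstoD)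
      then show "\<forall>\<^sub>F n in sequentially. \<forall>t\<in>UNIV. dist (u n t) (y t) < e"
        by eventually_elim (use uy in \<open>auto simp: dist_norm intro: le_less_trans\<close>)
    qed
    with u show ?thesis by (rule almost_automorphic_uniform_limit)
  qed
qed

theorem theorem4p3:
  fixes C1 C2 :: "real \<Rightarrow> real \<Rightarrow> 'x::banach \<times> 'x \<Rightarrow> 'x"
    and \<mu>1 \<mu>2 :: "real \<Rightarrow> real \<Rightarrow> real"
    and f :: "real \<Rightarrow> 'x \<times> 'x \<Rightarrow> 'x"
    and L\<^sub>f \<rho> :: real
    and a0 a1 a2 :: "real \<Rightarrow> real"
    and y :: "real \<Rightarrow> 'x"
  assumes "admissible_kernels C1 C2 \<mu>1 \<mu>2"
    and "almost_automorphic_param f"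
    and "\<And>B t. bounded B \<Longrightarrow> pair_lipschitz_on L\<^sub>f B (f t)"
    and "L\<^sub>f + (SUP t. integral {..t} (\<mu>1 t) + integral {t..} (\<mu>2 t)) = \<rho>"
    and "\<rho> < 1"
    and "almost_automorphic a0" and "almost_automorphic a1" and "almost_automorphic a2"
    and "bounded (range y)" and "continuous_on UNIV y"
    and "solves_integral_equation f C1 C2 a0 a1 a2 y"
  shows "almost_automorphic y \<longleftrightarrow> compact (closure (range y))"
  using almost_automorphic_relatively_compact solution_almost_automorphic[OF assms] by blast

end
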